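(* Let $\mathcal{A}$ be a Leibniz algebra over a field $F$ of characteristic zero and let $B$ be a subinvariant subalgebra of $\mathcal{A}$. Then $\mathrm{rad}(B) = B\cap \mathrm{rad}(\mathcal{A})$ and $\mathrm{nilrad}(B) = B\cap \mathrm{nilrad}(\mathcal{A})$.
   Context: A Leibniz algebra over a field $F$ means a finite-dimensional left Leibniz algebra: a finite-dimensional $F$-vector space with a bilinear product $(x,y)\mapsto xy$ such that $x(yz) = (xy)z + y(xz)$ for all $x,y,z$. Ideals are two-sided; $I \vartriangleleft J$ means $I$ is an ideal of $J$. For subspaces $X,Y$, $XY$ denotes the linear span of all products $xy$, $x\in X$, $y\in Y$. Set $\mathcal{A}^{(1)} = \mathcal{A} = \mathcal{A}^1$, $\mathcal{A}^{(i)} = \mathcal{A}^{(i-1)}\mathcal{A}^{(i-1)}$ and $\mathcal{A}^{i} = \mathcal{A}\mathcal{A}^{i-1}$ for $i \ge 2$. $\mathcal{A}$ is solvable (resp. nilpotent) if $\mathcal{A}^{(m)} = \{0\}$ (resp. $\mathcal{A}^m = \{0\}$) for some positive integer $m$. The maximal solvable (resp. nilpotent) ideal of $\mathcal{A}$ is the radical $\mathrm{rad}(\mathcal{A})$ (resp. nilradical $\mathrm{nilrad}(\mathcal{A})$). A subalgebra $B$ of $\mathcal{A}$ is subinvariant in $\mathcal{A}$ if there is a chain of subalgebras $B = B_t \subset B_{t-1} \subset \cdots \subset B_0 = \mathcal{A}$ with $B_i \vartriangleleft B_{i-1}$ for all $1 \leq i \leq t$. *)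

theory Defs
  imports Complex_Main
begin

locale leibniz_algebra = vector_space scale
  for scale :: "'f::field \<Rightarrow> 'a::ab_group_add \<Rightarrow> 'a" (infixr "*s" 75) +
  fixes mul :: "'a \<Rightarrow> 'a \<Rightarrow> 'a" (infixl "\<cdot>" 70)
  assumes finite_dim: "\<exists>S. finite S \<and> span S = UNIV"
    and linear_mul_left: "Vector_Spaces.linear scale scale (\<lambda>y. x \<cdot> y)"
    and linear_mul_right: "Vector_Spaces.linear scale scale (\<lambda>x. x \<cdot> y)"
    and left_leibniz: "x \<cdot> (y \<cdot> z) = (x \<cdot> y) \<cdot> z + y \<cdot> (x \<cdot> z)"
begin

definition subalgebra :: "'a set \<Rightarrow> bool" where
  "subalgebra B \<longleftrightarrow> subspace B \<and> (\<forall>x\<in>B. \<forall>y\<in>B. x \<cdot> y \<in> B)"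

definition ideal_of :: "'a set \<Rightarrow> 'a set \<Rightarrow> bool" where
  "ideal_of I J \<longleftrightarrow> subspace I \<and> I \<subseteq> J \<and> (\<forall>x\<in>I. \<forall>y\<in>J. x \<cdot> y \<in> I \<and> y \<cdot> x \<in> I)"

definition set_mul :: "'a set \<Rightarrow> 'a set \<Rightarrow> 'a set" where
  "set_mul X Y = span {x \<cdot> y | x y. x \<in> X \<and> y \<in> Y}"

text \<open>The usual numbering of both series starts at 1; here it is shifted to start at 0:
  \<open>derived_series X n\<close> is $X^{(n+1)}$ and \<open>lower_central_series X n\<close> is $X^{n+1}$.\<close>

primrec derived_series :: "'a set \<Rightarrow> nat \<Rightarrow> 'a set" where
  "derived_series X 0 = X"
| "derived_series X (Suc n) = set_mul (derived_series X n) (derived_series X n)"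

primrec lower_central_series :: "'a set \<Rightarrow> nat \<Rightarrow> 'a set" where
  "lower_central_series X 0 = X"
| "lower_central_series X (Suc n) = set_mul X (lower_central_series X n)"

definition solvable :: "'a set \<Rightarrow> bool" where
  "solvable X \<longleftrightarrow> (\<exists>n. derived_series X n = {0})"

definition nilpotent :: "'a set \<Rightarrow> bool" where
  "nilpotent X \<longleftrightarrow> (\<exists>n. lower_central_series X n = {0})"

text \<open>The radical and the nilradical are taken of an arbitrary subalgebra \<open>B\<close>, as ideals of \<open>B\<close>;
  the whole algebra is \<open>UNIV\<close>.\<close>

definition rad :: "'a set \<Rightarrow> 'a set" where
  "rad B = (THE R. ideal_of R B \<and> solvable R \<and>
     (\<forall>I. ideal_of I B \<and> solvable I \<and> R \<subseteq> I \<longrightarrow> I = R))"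

definition nilrad :: "'a set \<Rightarrow> 'a set" where
  "nilrad B = (THE N. ideal_of N B \<and> nilpotent N \<and>
     (\<forall>I. ideal_of I B \<and> nilpotent I \<and> N \<subseteq> I \<longrightarrow> I = N))"

definition subinvariant :: "'a set \<Rightarrow> 'a set \<Rightarrow> bool" where
  "subinvariant B A \<longleftrightarrow> (\<exists>t C. C 0 = A \<and> C t = B \<and> (\<forall>i\<le>t. subalgebra (C i)) \<and>
     (\<forall>i\<in>{1..t::nat}. ideal_of (C i) (C (i - 1))))"

end

end

theory Submission
  imports
    Defs
    "HOL-Computational_Algebra.Formal_Power_Series"
    "HOL-Computational_Algebra.Group_Closure"
begin

text \<open>By induction along the chain, it suffices that for an ideal \<open>I\<close> of \<open>A\<close> the (nil)radical \<open>R\<close> of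
  \<open>I\<close> is an ideal of \<open>A\<close>. Left multiplication by \<open>a \<in> A\<close> is a derivation \<open>D\<close> of \<open>I\<close>, and in
  characteristic zero \<open>\<phi> = exp (t D)\<close> is an automorphism of the power series algebra \<open>I[[t]]\<close>, so
  \<open>R[[t]] + \<phi> (R[[t]])\<close> is a sum of two solvable (nilpotent) ideals, hence solvable (nilpotent).
  Since \<open>t x + \<phi> y - y\<close> has leading coefficient \<open>x + D y\<close>, the ideal \<open>R + D R\<close> of \<open>I\<close> is again
  solvable (nilpotent), so \<open>D R \<subseteq> R\<close> by maximality. Right multiplication differs from left
  multiplication, up to sign, by elements of an abelian ideal of \<open>I\<close>.\<close>

text \<open>Solvability and nilpotency both say that all products of a certain bracketing shape vanish:
  complete binary trees for the derived series, right combs for the lower central series. This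
  form is insensitive to linear spans and treats both radicals at once.\<close>

datatype bracketing = Leaf | Node bracketing bracketing

primrec right_comb :: "nat \<Rightarrow> bracketing" where
  "right_comb 0 = Leaf"
| "right_comb (Suc n) = Node Leaf (right_comb n)"

primrec full_tree :: "nat \<Rightarrow> bracketing" where
  "full_tree 0 = Leaf"
| "full_tree (Suc n) = Node (full_tree n) (full_tree n)"

primrec products :: "('a \<Rightarrow> 'a \<Rightarrow> 'a) \<Rightarrow> 'a set \<Rightarrow> bracketing \<Rightarrow> 'a set" where
  "products m X Leaf = X"
| "products m X (Node s t) = {m x y | x y. x \<in> products m X s \<and> y \<in> products m X t}"

lemma products_mono: "X \<subseteq> Y \<Longrightarrow> products m X t \<subseteq> products m Y t"
proof (induction t)
  case (Node s t)
  then show ?case by (simp, blast)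
qed simp

text \<open>Transfer along a relation compatible with both multiplications, by induction on the
  bracketing. It serves for images under \<open>hs_map\<close> and for leading coefficients of power
  series.\<close>

lemma products_related:
  assumes "\<And>x. x \<in> X \<Longrightarrow> \<exists>u\<in>Y. R x u"
    and "\<And>x y u v. R x u \<Longrightarrow> R y v \<Longrightarrow> R (m x y) (m' u v)"
  shows "x \<in> products m X t \<Longrightarrow> \<exists>u\<in>products m' Y t. R x u"
proof (induction t arbitrary: x)
  case Leaf
  then show ?case using assms(1) by simp
next
  case (Node s t)
  then obtain a b where x: "x = m a b" "a \<in> products m X s" "b \<in> products m X t" by auto
  obtain u v where "u \<in> products m' Y s" "R a u" "v \<in> products m' Y t" "R b v"
    using Node.IH x by meson
  then have "m' u v \<in> products m' Y (Node s t)" "R x (m' u v)"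
    using assms(2) x(1) by auto
  then show ?case by blast
qed

text \<open>Grafting: a complete tree of depth \<open>k + n\<close> is one of depth \<open>n\<close>
  with complete trees of depth \<open>k\<close> hung at its leaves.\<close>

lemma products_full_tree_add:
  "products m X (full_tree (k + n)) = products m (products m X (full_tree k)) (full_tree n)"
  by (induction n) auto

section \<open>Additive subgroups and the subgroup generated by a set\<close>

definition additive_subgroup :: "'a::ab_group_add set \<Rightarrow> bool" where
  "additive_subgroup S \<longleftrightarrow> 0 \<in> S \<and> (\<forall>x\<in>S. \<forall>y\<in>S. x - y \<in> S)"

lemma additive_subgroup_zero: "additive_subgroup S \<Longrightarrow> 0 \<in> S"
  and additive_subgroup_diff: "additive_subgroup S \<Longrightarrow> x \<in> S \<Longrightarrow> y \<in> S \<Longrightarrow> x - y \<in> S"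
  by (auto simp: additive_subgroup_def)

lemma additive_subgroup_uminus: "additive_subgroup S \<Longrightarrow> x \<in> S \<Longrightarrow> - x \<in> S"
  using additive_subgroup_diff[of S 0 x] additive_subgroup_zero[of S] by simp

lemma additive_subgroup_add: "additive_subgroup S \<Longrightarrow> x \<in> S \<Longrightarrow> y \<in> S \<Longrightarrow> x + y \<in> S"
  using additive_subgroup_diff[of S x "- y"] additive_subgroup_uminus[of S y] by simp

lemma additive_subgroup_sum:
  "additive_subgroup S \<Longrightarrow> (\<And>i. i \<in> I \<Longrightarrow> f i \<in> S) \<Longrightarrow> sum f I \<in> S"
  by (induction I rule: infinite_finite_induct)
    (auto intro: additive_subgroup_zero additive_subgroup_add)

lemma additive_subgroup_group_closure: "additive_subgroup (group_closure S)"
  by (auto simp: additive_subgroup_def intro: group_closure.diff)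

lemma group_closure_least:
  assumes "additive_subgroup T" "S \<subseteq> T"
  shows "group_closure S \<subseteq> T"
proof
  fix x assume "x \<in> group_closure S"
  then show "x \<in> T"
    by induction (use assms in \<open>auto intro: additive_subgroup_zero additive_subgroup_diff\<close>)
qed

lemma subset_group_closure: "S \<subseteq> group_closure S"
  by (auto intro: group_closure.base)

section \<open>Leibniz rings and formal power series\<close>

text \<open>The Cauchy product over an arbitrary coefficient multiplication \<open>m\<close>, since
  the Leibniz product is a parameter and not a type class operation.\<close>

definition fps_conv :: "('a \<Rightarrow> 'a \<Rightarrow> 'a) \<Rightarrow> 'a fps \<Rightarrow> 'a fps \<Rightarrow> 'a::ab_group_add fps" where
  "fps_conv m f g = Abs_fps (\<lambda>n. \<Sum>i\<le>n. m (fps_nth f i) (fps_nth g (n - i)))"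

lemma fps_conv_nth: "fps_nth (fps_conv m f g) n = (\<Sum>i\<le>n. m (fps_nth f i) (fps_nth g (n - i)))"
  by (simp add: fps_conv_def)

text \<open>The terms of the Leibniz identity at coefficient \<open>n\<close> are sums over triples
  of exponents with total \<open>n\<close>, nested in three ways. This lemma and the next two bring
  them to one index set.\<close>

lemma sum_nested_assoc_left:
  "(\<Sum>k\<le>n. \<Sum>i\<le>k. G i (k - i) (n - k)) = (\<Sum>(i, j) | i + j \<le> n. G i j (n - (i + j)))"
  for G :: "nat \<Rightarrow> nat \<Rightarrow> nat \<Rightarrow> 'a::comm_monoid_add"
  by (simp add: sum.Sigma, rule sum.reindex_bij_witness
      [of _ "\<lambda>(i, j). (i + j, i)" "\<lambda>(k, i). (i, k - i)"]) auto

lemma sum_nested_assoc_right: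
  "(\<Sum>i\<le>n. \<Sum>j\<le>n - i. G i j (n - (i + j))) = (\<Sum>(i, j) | i + j \<le> n. G i j (n - (i + j)))"
  for G :: "nat \<Rightarrow> nat \<Rightarrow> nat \<Rightarrow> 'a::comm_monoid_add"
  by (simp add: sum.Sigma, rule sum.reindex_bij_witness [of _ "\<lambda>x. x" "\<lambda>x. x"]) auto

lemma sum_nested_swap:
  "(\<Sum>j\<le>n. \<Sum>i\<le>n - j. G i j (n - (j + i))) = (\<Sum>(i, j) | i + j \<le> n. G i j (n - (i + j)))"
  for G :: "nat \<Rightarrow> nat \<Rightarrow> nat \<Rightarrow> 'a::comm_monoid_add"
  by (simp add: sum.Sigma, rule sum.reindex_bij_witness [of _ "\<lambda>(i,j). (j,i)" "\<lambda>(i,j). (j,i)"])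
    (auto simp: add.commute)

text \<open>Scalars are dropped, so that one theory applies both to the algebra and to its formal
  power series, with additive subgroups in place of subspaces.\<close>

locale left_leibniz_ring =
  fixes mul :: "'a::ab_group_add \<Rightarrow> 'a \<Rightarrow> 'a" (infixl "\<cdot>" 70)
  assumes add_left: "(x + y) \<cdot> z = x \<cdot> z + y \<cdot> z"
    and add_right: "x \<cdot> (y + z) = x \<cdot> y + x \<cdot> z"
    and leibniz: "x \<cdot> (y \<cdot> z) = (x \<cdot> y) \<cdot> z + y \<cdot> (x \<cdot> z)"
begin

sublocale left: additive "\<lambda>x. x \<cdot> y" for y by unfold_locales (rule add_left)
sublocale right: additive "\<lambda>y. x \<cdot> y" for x by unfold_locales (rule add_right)

lemma leibniz_ring_fps: "left_leibniz_ring (fps_conv mul)"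
proof
  fix f g h :: "'a fps"
  show "fps_conv mul (f + g) h = fps_conv mul f h + fps_conv mul g h"
    by (rule fps_ext) (simp add: fps_conv_nth left.add sum.distrib)
  show "fps_conv mul f (g + h) = fps_conv mul f g + fps_conv mul f h"
    by (rule fps_ext) (simp add: fps_conv_nth right.add sum.distrib)
  show "fps_conv mul f (fps_conv mul g h)
      = fps_conv mul (fps_conv mul f g) h + fps_conv mul g (fps_conv mul f h)"
  proof (rule fps_ext)
    fix n
    let ?f = "fps_nth f" and ?g = "fps_nth g" and ?h = "fps_nth h"
    have "fps_nth (fps_conv mul f (fps_conv mul g h)) n
        = (\<Sum>(i, j) | i + j \<le> n. ?f i \<cdot> (?g j \<cdot> ?h (n - (i + j))))"
      by (simp add: fps_conv_nth right.sum sum_nested_assoc_right[of "\<lambda>i j k. ?f i \<cdot> (?g j \<cdot> ?h k)"])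
    also have "\<dots> = (\<Sum>(i, j) | i + j \<le> n. (?f i \<cdot> ?g j) \<cdot> ?h (n - (i + j)))
        + (\<Sum>(i, j) | i + j \<le> n. ?g j \<cdot> (?f i \<cdot> ?h (n - (i + j))))"
      by (simp add: leibniz[of "?f _"] case_prod_unfold flip: sum.distrib)
    also have "(\<Sum>(i, j) | i + j \<le> n. (?f i \<cdot> ?g j) \<cdot> ?h (n - (i + j)))
        = fps_nth (fps_conv mul (fps_conv mul f g) h) n"
      by (simp add: fps_conv_nth left.sum sum_nested_assoc_left[of "\<lambda>i j k. (?f i \<cdot> ?g j) \<cdot> ?h k"])
    also have "(\<Sum>(i, j) | i + j \<le> n. ?g j \<cdot> (?f i \<cdot> ?h (n - (i + j))))
        = fps_nth (fps_conv mul g (fps_conv mul f h)) n"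
      by (simp add: fps_conv_nth right.sum sum_nested_swap[of "\<lambda>i j k. ?g j \<cdot> (?f i \<cdot> ?h k)"])
    finally show "fps_nth (fps_conv mul f (fps_conv mul g h)) n =
        fps_nth (fps_conv mul (fps_conv mul f g) h + fps_conv mul g (fps_conv mul f h)) n" by simp
  qed
qed

section \<open>Ideals and sums of nilpotent ideals\<close>

definition ideal_in :: "'a set \<Rightarrow> 'a set \<Rightarrow> bool" where
  "ideal_in I A \<longleftrightarrow> additive_subgroup I \<and> I \<subseteq> A \<and> (\<forall>x\<in>I. \<forall>a\<in>A. x \<cdot> a \<in> I \<and> a \<cdot> x \<in> I)"

lemma ideal_inD:
  assumes "ideal_in I A"
  shows "additive_subgroup I" "I \<subseteq> A" "x \<in> I \<Longrightarrow> a \<in> A \<Longrightarrow> x \<cdot> a \<in> I" "x \<in> I \<Longrightarrow> a \<in> A \<Longrightarrow> a \<cdot> x \<in> I"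
  using assms by (auto simp: ideal_in_def)

lemma products_subset_ideal: "ideal_in I A \<Longrightarrow> products mul I t \<subseteq> I"
proof (induction t)
  case (Node s t)
  then show ?case
    unfolding products.simps using ideal_inD(2)[OF Node.prems] ideal_inD(3)[OF Node.prems] by blast
qed simp

lemma group_closure_mul:
  assumes "x \<in> group_closure X" "y \<in> group_closure Y"
  shows "x \<cdot> y \<in> group_closure {x \<cdot> y | x y. x \<in> X \<and> y \<in> Y}" (is "_ \<in> ?C")
proof -
  have base: "x \<cdot> y \<in> ?C" if "x \<in> X" for x
    using assms(2)
  proof induction
    case (base y)
    then show ?case using that by (auto simp: right.zero intro!: group_closure.base)
  next
    case (diff y z)
    then show ?case by (simp add: right.diff group_closure.diff)
  qed
  from assms(1) show ?thesis
  proof induction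
    case (base x)
    then show ?case using \<open>\<And>x. x \<in> X \<Longrightarrow> x \<cdot> y \<in> ?C\<close> by (auto simp: left.zero)
  next
    case (diff x z)
    then show ?case by (simp add: left.diff group_closure.diff)
  qed
qed

lemma mul_in_group_closure:
  "x \<in> X \<Longrightarrow> y \<in> Y \<Longrightarrow> x \<cdot> y \<in> group_closure {x \<cdot> y | x y. x \<in> X \<and> y \<in> Y}"
  by (auto intro!: subset_group_closure[THEN subsetD])

text \<open>The filtration starts at \<open>A\<close> rather than at \<open>I\<close>: factors lying outside \<open>I\<close> do not lower its
  level, which is what lets the filtrations of two ideals be combined.\<close>

primrec lower_filtration :: "'a set \<Rightarrow> 'a set \<Rightarrow> nat \<Rightarrow> 'a set" where
  "lower_filtration A I 0 = A"
| "lower_filtration A I (Suc p) = group_closure {x \<cdot> y | x y. x \<in> I \<and> y \<in> lower_filtration A I p}"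

text \<open>Left multiplication by \<open>a\<close> is a derivation: it sends
  \<open>u \<cdot> v\<close> to \<open>(a \<cdot> u) \<cdot> v + u \<cdot> (a \<cdot> v)\<close>,
  where \<open>a \<cdot> u\<close> stays in \<open>I\<close> and \<open>a \<cdot> v\<close> keeps
  its level by induction.\<close>

lemma lower_filtration_left_stable:
  assumes A: "additive_subgroup A" "\<And>x y. x \<in> A \<Longrightarrow> y \<in> A \<Longrightarrow> x \<cdot> y \<in> A" and I: "ideal_in I A"
    and "a \<in> A"
  shows "x \<in> lower_filtration A I p \<Longrightarrow> a \<cdot> x \<in> lower_filtration A I p"
proof (induction p arbitrary: x)
  case 0
  then show ?case using assms by simp
next
  case (Suc p)
  let ?C = "group_closure {x \<cdot> y | x y. x \<in> I \<and> y \<in> lower_filtration A I p}"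
  from Suc.prems have "x \<in> ?C" by simp
  then have "a \<cdot> x \<in> ?C"
  proof induction
    case (base x)
    then consider "x = 0" | u v where "x = u \<cdot> v" "u \<in> I" "v \<in> lower_filtration A I p" by auto
    then show ?case
    proof cases
      case 1
      then show ?thesis by (simp add: right.zero)
    next
      case 2
      have "(a \<cdot> u) \<cdot> v \<in> ?C" "u \<cdot> (a \<cdot> v) \<in> ?C"
        using mul_in_group_closure 2(2,3) Suc.IH ideal_inD(4)[OF I] \<open>a \<in> A\<close> by blast+
      then show ?thesis unfolding 2(1) leibniz[of a] by (rule group_closure_add)
    qed
  next
    case (diff x y)
    then show ?case by (simp add: right.diff group_closure.diff)
  qed
  then show ?case by simp
qed

text \<open>The start at \<open>A\<close> costs one step: level 1 is generated by products of
  \<open>I\<close> with \<open>A\<close>, which lie in \<open>I\<close>, the products of shape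
  \<open>right_comb 0\<close>.\<close>

lemma lower_filtration_Suc_subset:
  assumes I: "ideal_in I A"
  shows "lower_filtration A I (Suc p) \<subseteq> group_closure (products mul I (right_comb p))"
proof (induction p)
  case 0
  have "group_closure {x \<cdot> y |x y. x \<in> I \<and> y \<in> A} \<subseteq> I"
    using ideal_inD(3)[OF I] by (intro group_closure_least ideal_inD(1)[OF I]) auto
  then show ?case using subset_group_closure by auto
next
  case (Suc p)
  have "x \<cdot> y \<in> group_closure (products mul I (right_comb (Suc p)))"
    if "x \<in> I" "y \<in> lower_filtration A I (Suc p)" for x y
    using group_closure_mul[of x I y "products mul I (right_comb p)"] that Suc
    by (auto intro: group_closure.base)
  then show ?case
    unfolding lower_filtration.simps(2)[of A I "Suc p"]
    by (intro group_closure_least additive_subgroup_group_closure) auto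
qed

lemma lower_filtration_vanish:
  assumes "ideal_in I A" "products mul I (right_comb n) \<subseteq> {0}" "Suc n \<le> p"
  shows "lower_filtration A I p \<subseteq> {0}"
  using assms(3)
proof (induction p rule: dec_induct)
  case base
  have "group_closure (products mul I (right_comb n)) \<subseteq> {0}"
    using assms(2) by (intro group_closure_least) (auto simp: additive_subgroup_def)
  then show ?case using lower_filtration_Suc_subset[OF assms(1)] by blast
next
  case (step p)
  have "group_closure {x \<cdot> y | x y. x \<in> I \<and> y \<in> lower_filtration A I p} \<subseteq> {0}"
    using step.IH by (intro group_closure_least) (auto simp: additive_subgroup_def right.zero)
  then show ?case by simp
qed

text \<open>Count levels in both filtrations together: \<open>G k\<close> has total level
  \<open>k\<close>. A left factor from \<open>I\<close> raises the level in \<open>F\<close> and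
  keeps that in \<open>H\<close>, a factor from \<open>J\<close> does the reverse, so every factor
  from the sum raises the total by one.\<close>

lemma nilpotent_sum:
  assumes A: "additive_subgroup A" "\<And>x y. x \<in> A \<Longrightarrow> y \<in> A \<Longrightarrow> x \<cdot> y \<in> A"
    and I: "ideal_in I A" and J: "ideal_in J A"
    and nI: "products mul I (right_comb m) \<subseteq> {0}" and nJ: "products mul J (right_comb n) \<subseteq> {0}"
  shows "products mul {x + y | x y. x \<in> I \<and> y \<in> J} (right_comb (m + n + 2)) \<subseteq> {0}"
proof -
  define F where "F = lower_filtration A I"
  define H where "H = lower_filtration A J"
  define G where "G k = group_closure (\<Union>p\<le>k. F p \<inter> H (k - p))" for k
  let ?U = "{x + y | x y. x \<in> I \<and> y \<in> J}"
  have G_member: "g \<in> G k" if "p \<le> k" "g \<in> F p" "g \<in> H (k - p)" for g p k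
    unfolding G_def using that by (intro subset_group_closure[THEN subsetD]) blast
  have step: "u \<cdot> g \<in> G (Suc k)" if u: "u \<in> ?U" and g: "g \<in> G k" for u g k
  proof -
    obtain x y where xy: "u = x + y" "x \<in> I" "y \<in> J" using u by auto
    from g show ?thesis unfolding G_def[of k]
    proof induction
      case (base g)
      show ?case
      proof (cases "g = 0")
        case True
        then show ?thesis by (simp add: right.zero G_def)
      next
        case False
        then obtain p where p: "p \<le> k" "g \<in> F p" "g \<in> H (k - p)" using base by auto
        have xyA: "x \<in> A" "y \<in> A" using xy ideal_inD(2)[OF I] ideal_inD(2)[OF J] by auto
        have "x \<cdot> g \<in> F (Suc p)" "y \<cdot> g \<in> H (Suc (k - p))"
          using p xy by (auto simp: F_def H_def intro!: group_closure.base)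
        moreover have "y \<cdot> g \<in> F p" "x \<cdot> g \<in> H (k - p)"
          using p lower_filtration_left_stable[OF A I xyA(2)] lower_filtration_left_stable[OF A J xyA(1)]
          unfolding F_def H_def by blast+
        ultimately have "x \<cdot> g \<in> G (Suc k)" "y \<cdot> g \<in> G (Suc k)"
          using G_member[of "Suc p" "Suc k"] G_member[of p "Suc k"] p(1) by (simp_all add: Suc_diff_le)
        then show ?thesis unfolding xy(1) left.add G_def by (rule group_closure_add)
      qed
    next
      case (diff g h)
      then show ?case by (simp add: right.diff G_def group_closure.diff)
    qed
  qed
  have "?U \<subseteq> A"
    using additive_subgroup_add[OF A(1)] ideal_inD(2)[OF I] ideal_inD(2)[OF J] by auto
  then have "products mul ?U (right_comb k) \<subseteq> G k" for k
  proof (induction k)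
    case 0
    then show ?case by (auto simp: G_def F_def H_def intro: group_closure.base)
  next
    case (Suc k)
    show ?case
    proof
      fix z assume "z \<in> products mul ?U (right_comb (Suc k))"
      then obtain u g where "z = u \<cdot> g" "u \<in> ?U" "g \<in> products mul ?U (right_comb k)"
        unfolding right_comb.simps products.simps by blast
      then show "z \<in> G (Suc k)" using step Suc by blast
    qed
  qed
  moreover have "G (m + n + 2) \<subseteq> {0}"
    unfolding G_def
  proof (rule group_closure_least)
    show "additive_subgroup {0::'a}" by (simp add: additive_subgroup_def)
    have F0: "F p \<subseteq> {0}" if "Suc m \<le> p" for p
      unfolding F_def using lower_filtration_vanish[OF I nI that] .
    have H0: "H p \<subseteq> {0}" if "Suc n \<le> p" for p
      unfolding H_def using lower_filtration_vanish[OF J nJ that] .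
    show "(\<Union>p\<le>m + n + 2. F p \<inter> H (m + n + 2 - p)) \<subseteq> {0}"
    proof (intro UN_least)
      fix p assume "p \<in> {..m + n + 2}"
      \<comment> \<open>If \<open>p \<le> m\<close>, then the other level is at least
        \<open>n + 2\<close>; so one of the two filtrations has already reached zero.\<close>
      then have "Suc m \<le> p \<or> Suc n \<le> m + n + 2 - p" by auto
      then show "F p \<inter> H (m + n + 2 - p) \<subseteq> {0}" using F0[of p] H0[of "m + n + 2 - p"] by blast
    qed
  qed
  ultimately show ?thesis by blast
qed

end

section \<open>Power series over a subset, leading coefficients and sums of solvable ideals\<close>

definition fps_over :: "'a set \<Rightarrow> 'a fps set" where
  "fps_over S = {f. \<forall>n. fps_nth f n \<in> S}"

lemma additive_subgroup_fps_over: "additive_subgroup S \<Longrightarrow> additive_subgroup (fps_over S)"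
  by (auto simp: additive_subgroup_def fps_over_def)

text \<open>The coefficient \<open>x\<close> may be 0, so that the relation survives products whose
  leading coefficients multiply to 0. The zero series is related only to 0.\<close>

definition has_leading_coeff :: "'a::zero fps \<Rightarrow> 'a \<Rightarrow> bool" where
  "has_leading_coeff f x \<longleftrightarrow> (\<exists>r. fps_nth f r = x \<and> (\<forall>i<r. fps_nth f i = 0))"

definition vanishing :: "(nat \<Rightarrow> bracketing) \<Rightarrow> ('a \<Rightarrow> 'a \<Rightarrow> 'a) \<Rightarrow> 'a::zero set \<Rightarrow> bool" where
  "vanishing sh m X \<longleftrightarrow> (\<exists>n. products m X (sh n) \<subseteq> {0})"

lemma vanishing_subset: "vanishing sh m Y \<Longrightarrow> X \<subseteq> Y \<Longrightarrow> vanishing sh m X"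
  unfolding vanishing_def using products_mono[of X Y m] by (meson subset_trans)

context left_leibniz_ring
begin

text \<open>Computation modulo \<open>I\<close>: when a product of sums is expanded, every term with
  a factor from \<open>I\<close> falls into \<open>I\<close>.\<close>

lemma products_set_sum_subset:
  assumes I: "ideal_in I A" and J: "ideal_in J A"
  shows "products mul {x + y | x y. x \<in> I \<and> y \<in> J} t \<subseteq> {x + y | x y. x \<in> I \<and> y \<in> products mul J t}"
proof (induction t)
  case (Node s t)
  show ?case
  proof
    fix z assume "z \<in> products mul {x + y | x y. x \<in> I \<and> y \<in> J} (Node s t)"
    then obtain x y x' y' where z: "z = (x + y) \<cdot> (x' + y')" "x \<in> I" "x' \<in> I"
      "y \<in> products mul J s" "y' \<in> products mul J t"
      using Node by fastforce
    have "y \<in> A" "y' \<in> A" "x' \<in> A"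
      using z products_subset_ideal[OF J] ideal_inD(2)[OF J] ideal_inD(2)[OF I] by blast+
    then have "x \<cdot> x' + x \<cdot> y' + y \<cdot> x' \<in> I"
      using z ideal_inD(3,4)[OF I] by (auto intro!: additive_subgroup_add[OF ideal_inD(1)[OF I]])
    moreover have "y \<cdot> y' \<in> products mul J (Node s t)" using z by auto
    moreover have "z = (x \<cdot> x' + x \<cdot> y' + y \<cdot> x') + y \<cdot> y'"
      unfolding z(1) by (simp add: add_left add_right ac_simps)
    ultimately show "z \<in> {x + y | x y. x \<in> I \<and> y \<in> products mul J (Node s t)}" by blast
  qed
qed simp

text \<open>At depth \<open>n\<close> the part from \<open>J\<close> has vanished, so the products
  lie in \<open>I\<close>; another \<open>m\<close> levels annihilate them.\<close>

lemma solvable_sum: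
  assumes "ideal_in I A" "ideal_in J A"
    and "products mul I (full_tree m) \<subseteq> {0}" "products mul J (full_tree n) \<subseteq> {0}"
  shows "products mul {x + y | x y. x \<in> I \<and> y \<in> J} (full_tree (n + m)) \<subseteq> {0}"
proof -
  have "products mul {x + y | x y. x \<in> I \<and> y \<in> J} (full_tree n) \<subseteq> I"
    using products_set_sum_subset[OF assms(1,2), of "full_tree n"] assms(4) by fastforce
  then show ?thesis
    unfolding products_full_tree_add using products_mono assms(3) by (meson subset_trans)
qed

lemma vanishing_sum:
  assumes "sh \<in> {right_comb, full_tree}"
    and "additive_subgroup A" "\<And>x y. x \<in> A \<Longrightarrow> y \<in> A \<Longrightarrow> x \<cdot> y \<in> A"
    and "ideal_in I A" "ideal_in J A" "vanishing sh mul I" "vanishing sh mul J"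
  shows "vanishing sh mul {x + y | x y. x \<in> I \<and> y \<in> J}"
proof -
  obtain m n where "products mul I (sh m) \<subseteq> {0}" "products mul J (sh n) \<subseteq> {0}"
    using assms(6,7) unfolding vanishing_def by blast
  then show ?thesis
    using assms(1) nilpotent_sum[OF assms(2-5), of m n] solvable_sum[OF assms(4,5), of m n]
    unfolding vanishing_def by fast
qed

text \<open>With leading positions \<open>r\<close> and \<open>s\<close>, only the term
  \<open>i = r\<close> survives in coefficient \<open>r + s\<close>, and no term survives below
  it.\<close>

lemma has_leading_coeff_conv:
  assumes "has_leading_coeff f x" "has_leading_coeff g y"
  shows "has_leading_coeff (fps_conv mul f g) (x \<cdot> y)"
proof -
  obtain r s where r: "fps_nth f r = x" "\<And>i. i < r \<Longrightarrow> fps_nth f i = 0"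
    and s: "fps_nth g s = y" "\<And>i. i < s \<Longrightarrow> fps_nth g i = 0"
    using assms unfolding has_leading_coeff_def by blast
  have "(\<Sum>i\<le>r + s. fps_nth f i \<cdot> fps_nth g (r + s - i))
      = (\<Sum>i\<in>{r}. fps_nth f i \<cdot> fps_nth g (r + s - i))"
  proof (rule sum.mono_neutral_right)
    show "\<forall>i\<in>{..r + s} - {r}. fps_nth f i \<cdot> fps_nth g (r + s - i) = 0"
    proof
      fix i assume "i \<in> {..r + s} - {r}"
      then have "i < r \<or> r + s - i < s" by auto
      then show "fps_nth f i \<cdot> fps_nth g (r + s - i) = 0"
        using r s by (auto simp: left.zero right.zero)
    qed
  qed auto
  moreover have "fps_nth (fps_conv mul f g) n = 0" if "n < r + s" for n
    unfolding fps_conv_nth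
  proof (intro sum.neutral ballI)
    fix i assume "i \<in> {..n}"
    then have "i < r \<or> n - i < s" using that by auto
    then show "fps_nth f i \<cdot> fps_nth g (n - i) = 0"
      using r s by (auto simp: left.zero right.zero)
  qed
  ultimately show ?thesis
    unfolding has_leading_coeff_def using r s by (auto simp: fps_conv_nth intro!: exI[of _ "r + s"])
qed

text \<open>A coefficient of a Cauchy product is a sum of products, whence the generated subgroup.
  If that subgroup is zero, the products of series vanish too.\<close>

lemma products_fps_over:
  "f \<in> products (fps_conv mul) (fps_over I) t \<Longrightarrow> fps_nth f n \<in> group_closure (products mul I t)"
proof (induction t arbitrary: f n)
  case Leaf
  then show ?case by (auto simp: fps_over_def intro: group_closure.base)
next
  case (Node s t)
  then obtain g h where f: "f = fps_conv mul g h" "g \<in> products (fps_conv mul) (fps_over I) s"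
    "h \<in> products (fps_conv mul) (fps_over I) t" by auto
  have "fps_nth g i \<cdot> fps_nth h (n - i) \<in> group_closure (products mul I (Node s t))" for i
    using group_closure_mul[OF Node.IH(1)[OF f(2)] Node.IH(2)[OF f(3)]] by simp
  then show ?case
    unfolding f(1) fps_conv_nth by (intro additive_subgroup_sum[OF additive_subgroup_group_closure])
qed

lemma vanishing_fps_over:
  assumes "vanishing sh mul I" shows "vanishing sh (fps_conv mul) (fps_over I)"
proof -
  obtain n where "products mul I (sh n) \<subseteq> {0}" using assms by (auto simp: vanishing_def)
  then have "group_closure (products mul I (sh n)) \<subseteq> {0}"
    by (intro group_closure_least) (auto simp: additive_subgroup_def)
  then have "products (fps_conv mul) (fps_over I) (sh n) \<subseteq> {0}"
    using products_fps_over[of _ I "sh n"] by (fastforce simp: fps_eq_iff)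
  then show ?thesis by (auto simp: vanishing_def)
qed

lemma ideal_in_fps_over:
  assumes "ideal_in I A"
  shows "left_leibniz_ring.ideal_in (fps_conv mul) (fps_over I) (fps_over A)"
proof -
  interpret F: left_leibniz_ring "fps_conv mul" by (rule leibniz_ring_fps)
  show ?thesis
    unfolding F.ideal_in_def using ideal_inD[OF assms]
    by (auto simp: additive_subgroup_fps_over)
      (auto simp: fps_over_def fps_conv_nth intro!: additive_subgroup_sum)
qed

end

section \<open>Hasse-Schmidt derivations\<close>

text \<open>The model is \<open>d n\<close> = D^n / n! for a derivation D. Only the laws of these
  divided powers are assumed, which keeps division out of the power series argument.\<close>

locale hasse_schmidt_derivation = left_leibniz_ring mul
  for mul :: "'a::ab_group_add \<Rightarrow> 'a \<Rightarrow> 'a" (infixl "\<cdot>" 70) +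
  fixes d :: "nat \<Rightarrow> 'a \<Rightarrow> 'a"
  assumes d_add: "d n (x + y) = d n x + d n y"
    and d_0: "d 0 x = x"
    and d_mul: "d n (x \<cdot> y) = (\<Sum>i\<le>n. d i x \<cdot> d (n - i) y)"
begin

sublocale d: additive "d n" for n by unfold_locales (rule d_add)

text \<open>The action of the operator series with coefficients \<open>d n\<close>, extended to
  power series; for divided powers this is exp (t D).\<close>

definition hs_map :: "'a fps \<Rightarrow> 'a fps" where
  "hs_map f = Abs_fps (\<lambda>n. \<Sum>i\<le>n. d (n - i) (fps_nth f i))"

lemma hs_map_nth: "fps_nth (hs_map f) n = (\<Sum>i\<le>n. d (n - i) (fps_nth f i))"
  by (simp add: hs_map_def)

lemma hs_map_diff: "hs_map (f - g) = hs_map f - hs_map g"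
  by (rule fps_ext) (simp add: hs_map_nth d.diff sum_subtractf)

lemma hs_map_zero: "hs_map 0 = 0"
  by (rule fps_ext) (simp add: hs_map_nth d.zero)

lemma hs_map_conv: "hs_map (fps_conv mul f g) = fps_conv mul (hs_map f) (hs_map g)"
proof (rule fps_ext)
  fix n
  let ?f = "fps_nth f" and ?g = "fps_nth g"
  have "fps_nth (hs_map (fps_conv mul f g)) n
      = (\<Sum>m\<le>n. \<Sum>p\<le>m. \<Sum>a\<le>n - m. d a (?f p) \<cdot> d (n - m - a) (?g (m - p)))"
    by (simp add: hs_map_nth fps_conv_nth d.sum d_mul)
  also have "\<dots> = (\<Sum>(m, p, a)\<in>(SIGMA m:{..n}. {..m} \<times> {..n - m}). d a (?f p) \<cdot> d (n - m - a) (?g (m - p)))"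
    by (simp add: sum.Sigma sum.cartesian_product)
  \<comment> \<open>The new \<open>m\<close> is \<open>a + p\<close>, the degree in t contributed by
    \<open>hs_map f\<close>, and \<open>q\<close> is the old \<open>m - p\<close>, the index of the
    coefficient of \<open>g\<close>.\<close>
  also have "\<dots> = (\<Sum>(m, p, q)\<in>(SIGMA m:{..n}. {..m} \<times> {..n - m}). d (m - p) (?f p) \<cdot> d (n - m - q) (?g q))"
    by (rule sum.reindex_bij_witness
        [of _ "\<lambda>(m, p, q). (q + p, p, m - p)" "\<lambda>(m, p, a). (a + p, p, m - p)"]) (auto simp: add.commute)
  also have "\<dots> = (\<Sum>m\<le>n. \<Sum>p\<le>m. \<Sum>q\<le>n - m. d (m - p) (?f p) \<cdot> d (n - m - q) (?g q))"
    by (simp add: sum.Sigma sum.cartesian_product)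
  also have "\<dots> = fps_nth (fps_conv mul (hs_map f) (hs_map g)) n"
    by (simp add: hs_map_nth fps_conv_nth left.sum right.sum) (rule sum.cong[OF refl sum.swap])
  finally show "fps_nth (hs_map (fps_conv mul f g)) n = fps_nth (fps_conv mul (hs_map f) (hs_map g)) n" .
qed

text \<open>As \<open>d 0\<close> is the identity, \<open>hs_map\<close> is unitriangular in the
  coefficients and can be inverted by forward substitution.\<close>

fun hs_preimage :: "'a fps \<Rightarrow> nat \<Rightarrow> 'a" where
  "hs_preimage g n = fps_nth g n - (\<Sum>i<n. d (n - i) (hs_preimage g i))"

declare hs_preimage.simps [simp del]

lemma hs_map_hs_preimage: "hs_map (Abs_fps (hs_preimage g)) = g"
proof (rule fps_ext)
  fix n
  have "fps_nth (hs_map (Abs_fps (hs_preimage g))) n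
      = (\<Sum>i<n. d (n - i) (hs_preimage g i)) + hs_preimage g n"
    by (simp add: hs_map_nth d_0 flip: lessThan_Suc_atMost)
  then show "fps_nth (hs_map (Abs_fps (hs_preimage g))) n = fps_nth g n"
    by (simp add: hs_preimage.simps[of g n])
qed

lemma fps_over_subset_hs_map_image:
  assumes A: "additive_subgroup A" "\<And>n x. x \<in> A \<Longrightarrow> d n x \<in> A"
  shows "fps_over A \<subseteq> hs_map ` fps_over A"
proof
  fix g assume g: "g \<in> fps_over A"
  have "hs_preimage g n \<in> A" for n
  proof (induction n rule: less_induct)
    case (less n)
    then show ?case
      using g A unfolding hs_preimage.simps[of g n]
      by (auto simp: fps_over_def intro!: additive_subgroup_diff additive_subgroup_sum)
  qed
  then have "Abs_fps (hs_preimage g) \<in> fps_over A" by (simp add: fps_over_def)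
  then show "g \<in> hs_map ` fps_over A" using hs_map_hs_preimage by (metis imageI)
qed

lemma hs_map_over:
  assumes "additive_subgroup A" "\<And>n x. x \<in> A \<Longrightarrow> d n x \<in> A" "f \<in> fps_over A"
  shows "hs_map f \<in> fps_over A"
  using assms by (auto simp: fps_over_def hs_map_nth intro!: additive_subgroup_sum)

text \<open>Every series over \<open>A\<close> is itself an image of one over \<open>A\<close>, so
  multiplying an image by it is again applying \<open>hs_map\<close> to a product.\<close>

lemma ideal_in_hs_map_image:
  assumes A: "additive_subgroup A" "\<And>n x. x \<in> A \<Longrightarrow> d n x \<in> A" and I: "ideal_in I A"
  shows "left_leibniz_ring.ideal_in (fps_conv mul) (hs_map ` fps_over I) (fps_over A)"
proof -
  interpret F: left_leibniz_ring "fps_conv mul" by (rule leibniz_ring_fps)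
  note FI = ideal_in_fps_over[OF I]
  show ?thesis
    unfolding F.ideal_in_def
  proof (intro conjI ballI)
    show "additive_subgroup (hs_map ` fps_over I)"
      unfolding additive_subgroup_def
    proof (intro conjI ballI)
      show "0 \<in> hs_map ` fps_over I"
        using hs_map_zero additive_subgroup_zero[OF F.ideal_inD(1)[OF FI]] by (metis imageI)
      fix f g assume "f \<in> hs_map ` fps_over I" "g \<in> hs_map ` fps_over I"
      then obtain f' g' where "f = hs_map f'" "g = hs_map g'" "f' \<in> fps_over I" "g' \<in> fps_over I"
        by blast
      then show "f - g \<in> hs_map ` fps_over I"
        using additive_subgroup_diff[OF F.ideal_inD(1)[OF FI]] by (simp flip: hs_map_diff)
    qed
    show "hs_map ` fps_over I \<subseteq> fps_over A"
      using hs_map_over[OF A] F.ideal_inD(2)[OF FI] by blast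
    fix f g assume "f \<in> hs_map ` fps_over I" "g \<in> fps_over A"
    then obtain f' g' where fg: "f = hs_map f'" "g = hs_map g'" "f' \<in> fps_over I" "g' \<in> fps_over A"
      using fps_over_subset_hs_map_image[OF A] by blast
    then show "fps_conv mul f g \<in> hs_map ` fps_over I" "fps_conv mul g f \<in> hs_map ` fps_over I"
      using F.ideal_inD(3,4)[OF FI fg(3,4)] by (auto simp flip: hs_map_conv)
  qed
qed

lemma vanishing_hs_map_image:
  assumes "vanishing sh (fps_conv mul) X" shows "vanishing sh (fps_conv mul) (hs_map ` X)"
proof -
  obtain n where n: "products (fps_conv mul) X (sh n) \<subseteq> {0}" using assms by (auto simp: vanishing_def)
  have "\<exists>g\<in>products (fps_conv mul) X t. f = hs_map g"
    if "f \<in> products (fps_conv mul) (hs_map ` X) t" for f t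
    by (rule products_related[OF _ _ that]) (auto simp: hs_map_conv)
  then have "products (fps_conv mul) (hs_map ` X) (sh n) \<subseteq> {0}"
    using n hs_map_zero by fastforce
  then show ?thesis by (auto simp: vanishing_def)
qed

text \<open>The sum \<open>?J\<close> of an ideal of power series and its image under
  \<open>hs_map\<close> has the vanishing property. Each \<open>x + d 1 y\<close> is a leading
  coefficient of a member of \<open>?J\<close>, and products of leading coefficients are leading
  coefficients of products.\<close>

lemma vanishing_derivation_sum:
  assumes sh: "sh \<in> {right_comb, full_tree}"
    and A: "additive_subgroup A" "\<And>x y. x \<in> A \<Longrightarrow> y \<in> A \<Longrightarrow> x \<cdot> y \<in> A" "\<And>n x. x \<in> A \<Longrightarrow> d n x \<in> A"
    and I: "ideal_in I A" "vanishing sh mul I"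
  shows "vanishing sh mul {x + d 1 y | x y. x \<in> I \<and> y \<in> I}"
proof -
  interpret F: left_leibniz_ring "fps_conv mul" by (rule leibniz_ring_fps)
  let ?J = "{f + g | f g. f \<in> fps_over I \<and> g \<in> hs_map ` fps_over I}"
  have "vanishing sh (fps_conv mul) ?J"
  proof (rule F.vanishing_sum[OF sh])
    show "additive_subgroup (fps_over A)" using A(1) by (rule additive_subgroup_fps_over)
    show "fps_conv mul f g \<in> fps_over A" if "f \<in> fps_over A" "g \<in> fps_over A" for f g
      using that A(1,2) by (auto simp: fps_over_def fps_conv_nth intro!: additive_subgroup_sum)
    show "F.ideal_in (fps_over I) (fps_over A)" by (rule ideal_in_fps_over[OF I(1)])
    show "F.ideal_in (hs_map ` fps_over I) (fps_over A)" by (rule ideal_in_hs_map_image[OF A(1,3) I(1)])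
    show "vanishing sh (fps_conv mul) (fps_over I)" by (rule vanishing_fps_over[OF I(2)])
    then show "vanishing sh (fps_conv mul) (hs_map ` fps_over I)" by (rule vanishing_hs_map_image)
  qed
  then obtain n where n: "products (fps_conv mul) ?J (sh n) \<subseteq> {0}" by (auto simp: vanishing_def)
  have lift: "\<exists>f\<in>?J. has_leading_coeff f z" if z: "z \<in> {x + d 1 y | x y. x \<in> I \<and> y \<in> I}" for z
  proof -
    obtain x y where z: "z = x + d 1 y" "x \<in> I" "y \<in> I" using z by auto
    \<comment> \<open>With \<open>\<phi> = hs_map\<close> this is \<open>x t + (\<phi> y - y)\<close>, whose leading term is \<open>(x + d 1 y) t\<close>.\<close>
    let ?f = "Abs_fps (\<lambda>n. if n = 0 then - y else if n = 1 then x else 0)"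
    let ?g = "Abs_fps (\<lambda>n. if n = 0 then y else 0)"
    have "?f \<in> fps_over I" "?g \<in> fps_over I"
      using z additive_subgroup_zero[OF ideal_inD(1)[OF I(1)]]
        additive_subgroup_uminus[OF ideal_inD(1)[OF I(1)]] by (auto simp: fps_over_def)
    then have "?f + hs_map ?g \<in> ?J" by blast
    moreover have "has_leading_coeff (?f + hs_map ?g) z"
      unfolding has_leading_coeff_def using z
      by (intro exI[of _ 1]) (auto simp: hs_map_nth d.zero d_0)
    ultimately show ?thesis by blast
  qed
  have "z = 0" if "z \<in> products mul {x + d 1 y | x y. x \<in> I \<and> y \<in> I} (sh n)" for z
  proof -
    have "\<exists>f\<in>products (fps_conv mul) ?J (sh n). has_leading_coeff f z"
      by (rule products_related[where R = "\<lambda>z f. has_leading_coeff f z", OF lift has_leading_coeff_conv that])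
    then show "z = 0" using n by (auto simp: has_leading_coeff_def)
  qed
  then show ?thesis unfolding vanishing_def by blast
qed

end

section \<open>Radicals of Leibniz algebras\<close>

context leibniz_algebra
begin

section \<open>Spans, the two series in terms of bracketed products, and maximal subspaces\<close>

lemma mul_add_left: "(x + y) \<cdot> z = x \<cdot> z + y \<cdot> z"
  and mul_scale_left: "(c *s x) \<cdot> y = c *s (x \<cdot> y)"
  using linear_mul_right by (simp_all add: Vector_Spaces.linear_iff)

lemma mul_add_right: "x \<cdot> (y + z) = x \<cdot> y + x \<cdot> z"
  and mul_scale_right: "x \<cdot> (c *s y) = c *s (x \<cdot> y)"
  using linear_mul_left by (simp_all add: Vector_Spaces.linear_iff)

sublocale ring: left_leibniz_ring mul
  by unfold_locales (rule mul_add_left mul_add_right left_leibniz)+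

lemma additive_subgroup_subspace: "subspace S \<Longrightarrow> additive_subgroup S"
  by (auto simp: additive_subgroup_def subspace_0 subspace_diff)

lemma ideal_in_ideal_of: "ideal_of I A \<Longrightarrow> ring.ideal_in I A"
  by (auto simp: ring.ideal_in_def ideal_of_def additive_subgroup_subspace)

lemma ideal_ofD:
  assumes "ideal_of I A"
  shows "subspace I" "I \<subseteq> A" "x \<in> I \<Longrightarrow> a \<in> A \<Longrightarrow> x \<cdot> a \<in> I" "x \<in> I \<Longrightarrow> a \<in> A \<Longrightarrow> a \<cdot> x \<in> I"
  using assms by (auto simp: ideal_of_def)

lemma subalgebra_ideal_of: "ideal_of I A \<Longrightarrow> subalgebra I"
  by (auto simp: ideal_of_def subalgebra_def)

lemma mul_span:
  assumes "x \<in> span X" "y \<in> span Y"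
  shows "x \<cdot> y \<in> span {x \<cdot> y | x y. x \<in> X \<and> y \<in> Y}" (is "_ \<in> ?S")
  using assms(1)
proof (induction rule: span_induct_alt)
  case base
  then show ?case by (simp add: ring.left.zero span_zero)
next
  case (step c x x')
  have "x \<cdot> y \<in> ?S"
    using assms(2)
  proof (induction rule: span_induct_alt)
    case base
    then show ?case by (simp add: ring.right.zero span_zero)
  next
    case (step c y y')
    have "x \<cdot> y \<in> ?S" using step \<open>x \<in> X\<close> by (auto intro: span_base)
    then show ?case using step by (simp add: mul_add_right mul_scale_right span_add span_scale)
  qed
  then show ?case using step by (simp add: mul_add_left mul_scale_left span_add span_scale)
qed

text \<open>By bilinearity the spans taken at each stage of a series can be postponed to a single
  span at the end.\<close>

lemma set_mul_span: "set_mul (span X) (span Y) = span {x \<cdot> y | x y. x \<in> X \<and> y \<in> Y}"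
  unfolding set_mul_def
proof (rule antisym)
  show "span {x \<cdot> y |x y. x \<in> span X \<and> y \<in> span Y} \<subseteq> span {x \<cdot> y | x y. x \<in> X \<and> y \<in> Y}"
    by (rule span_minimal) (auto intro: mul_span)
  show "span {x \<cdot> y | x y. x \<in> X \<and> y \<in> Y} \<subseteq> span {x \<cdot> y |x y. x \<in> span X \<and> y \<in> span Y}"
    by (rule span_mono) (auto intro: span_base)
qed

lemma derived_series_eq_span:
  "subspace X \<Longrightarrow> derived_series X n = span (products mul X (full_tree n))"
  by (induction n) (simp_all add: set_mul_span span_eq_iff[THEN iffD2])

lemma lower_central_series_eq_span:
  assumes "subspace X" shows "lower_central_series X n = span (products mul X (right_comb n))"
proof (induction n)
  case 0
  then show ?case using assms by (simp add: span_eq_iff[THEN iffD2])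
next
  case (Suc n)
  have "set_mul X (lower_central_series X n)
      = set_mul (span X) (span (products mul X (right_comb n)))"
    using assms Suc by (simp add: span_eq_iff[THEN iffD2])
  then show ?case by (simp add: set_mul_span)
qed

lemma span_eq_zero_iff: "span S = {0} \<longleftrightarrow> S \<subseteq> {0}"
proof
  show "S \<subseteq> {0}" if "span S = {0}" using that span_superset[of S] by simp
  show "span S = {0}" if "S \<subseteq> {0}"
    using span_mono[OF that] span_zero[of S] span_eq_iff[of "{0}"] subspace_single_0 by auto
qed

lemma solvable_iff_vanishing: "subspace X \<Longrightarrow> solvable X \<longleftrightarrow> vanishing full_tree mul X"
  by (simp add: solvable_def vanishing_def derived_series_eq_span span_eq_zero_iff)

lemma nilpotent_iff_vanishing: "subspace X \<Longrightarrow> nilpotent X \<longleftrightarrow> vanishing right_comb mul X"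
  by (simp add: nilpotent_def vanishing_def lower_central_series_eq_span span_eq_zero_iff)

lemma ideal_of_set_sum:
  assumes A: "subalgebra A" and I: "ideal_of I A" and J: "ideal_of J A"
  shows "ideal_of {x + y | x y. x \<in> I \<and> y \<in> J} A"
proof -
  have "\<exists>u v. (x + y) \<cdot> a = u + v \<and> u \<in> I \<and> v \<in> J" "\<exists>u v. a \<cdot> (x + y) = u + v \<and> u \<in> I \<and> v \<in> J"
    if "x \<in> I" "y \<in> J" "a \<in> A" for x y a
    using that ideal_ofD(3,4)[OF I] ideal_ofD(3,4)[OF J] mul_add_left mul_add_right by metis+
  moreover have "x + y \<in> A" if "x \<in> I" "y \<in> J" for x y
    using that A ideal_ofD(2)[OF I] ideal_ofD(2)[OF J] by (auto simp: subalgebra_def intro: subspace_add)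
  ultimately show ?thesis
    using subspace_sums[OF ideal_ofD(1)[OF I] ideal_ofD(1)[OF J]] unfolding ideal_of_def by blast
qed

text \<open>Dimensions are bounded, so some member of \<open>Q\<close> has greatest dimension; a
  larger member has the same dimension and hence coincides with it.\<close>

lemma exists_max_subspace:
  assumes "Q S0" "\<And>S. Q S \<Longrightarrow> subspace S"
  obtains S where "Q S" "\<And>T. Q T \<Longrightarrow> S \<subseteq> T \<Longrightarrow> T = S"
proof -
  obtain S where S: "finite S" "span S = UNIV" using finite_dim by blast
  obtain E where E: "E \<subseteq> S" "independent E" "span E = UNIV"
    using maximal_independent_subset[of S] S(2) span_mono[of S] span_span
    by (metis span_minimal subspace_span top.extremum_uniqueI)
  interpret fd: finite_dimensional_vector_space scale E
    using E S finite_subset by unfold_locales auto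
  obtain M where M: "Q M" "\<And>T. Q T \<Longrightarrow> dim T \<le> dim M"
    using ex_has_greatest_nat[of Q S0 dim "Suc fd.dimension"] assms(1) fd.dim_subset_UNIV
    by (metis le_imp_less_Suc)
  show ?thesis
  proof (rule that[OF M(1)])
    fix T assume "Q T" "M \<subseteq> T"
    then show "T = M" using M assms(2) fd.subspace_dim_equal by metis
  qed
qed

end

section \<open>Radical and nilradical treated together in characteristic zero\<close>

locale radical_property = leibniz_algebra scale mul
  for scale :: "'f::field_char_0 \<Rightarrow> 'a::ab_group_add \<Rightarrow> 'a" (infixr "*s" 75)
    and mul :: "'a \<Rightarrow> 'a \<Rightarrow> 'a" (infixl "\<cdot>" 70) +
  fixes P :: "'a set \<Rightarrow> bool" and sh :: "nat \<Rightarrow> bracketing"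
  assumes sh: "sh \<in> {right_comb, full_tree}"
    and P_iff: "subspace X \<Longrightarrow> P X \<longleftrightarrow> vanishing sh mul X"
begin

text \<open>The description shared by \<open>rad\<close> and \<open>nilrad\<close>, which are
  recovered by taking \<open>solvable\<close> or \<open>nilpotent\<close> for
  \<open>P\<close>.\<close>

definition radical :: "'a set \<Rightarrow> 'a set" where
  "radical A = (THE R. ideal_of R A \<and> P R \<and> (\<forall>I. ideal_of I A \<and> P I \<and> R \<subseteq> I \<longrightarrow> I = R))"

lemma P_subspace_mono: "P Y \<Longrightarrow> subspace X \<Longrightarrow> subspace Y \<Longrightarrow> X \<subseteq> Y \<Longrightarrow> P X"
  using P_iff vanishing_subset by metis

lemma P_zero_mul:
  assumes "subspace X" "\<And>x y. x \<in> X \<Longrightarrow> y \<in> X \<Longrightarrow> x \<cdot> y = 0"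
  shows "P X"
proof -
  \<comment> \<open>Both shapes at index 1 are the single product
    \<open>Node Leaf Leaf\<close>.\<close>
  have "products mul X (sh 1) \<subseteq> {0}" using sh assms(2) by auto
  then show ?thesis using P_iff[OF assms(1)] by (auto simp: vanishing_def)
qed

lemma P_sum:
  assumes A: "subalgebra A" and I: "ideal_of I A" "P I" and J: "ideal_of J A" "P J"
  shows "P {x + y | x y. x \<in> I \<and> y \<in> J}"
proof -
  have "vanishing sh mul {x + y | x y. x \<in> I \<and> y \<in> J}"
    using A I J P_iff[OF ideal_ofD(1)] ideal_in_ideal_of
    by (intro ring.vanishing_sum[OF sh, of A])
      (auto simp: subalgebra_def additive_subgroup_subspace)
  then show ?thesis using P_iff ideal_ofD(1)[OF ideal_of_set_sum[OF A I(1) J(1)]] by blast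
qed

text \<open>A maximal ideal with \<open>P\<close> exists by dimension. Its sum with any other such
  ideal again has \<open>P\<close>, so it is the greatest one; this gives the uniqueness that the
  definite description requires.\<close>

lemma radical_greatest:
  assumes A: "subalgebra A"
  shows "ideal_of (radical A) A" "P (radical A)" "ideal_of I A \<Longrightarrow> P I \<Longrightarrow> I \<subseteq> radical A"
proof -
  have "subspace A" using A by (simp add: subalgebra_def)
  then have "ideal_of {0} A" "P {0}"
    by (auto simp: ideal_of_def subspace_0 ring.left.zero ring.right.zero intro!: P_zero_mul)
  then obtain R where R: "ideal_of R A" "P R" "\<And>T. ideal_of T A \<and> P T \<Longrightarrow> R \<subseteq> T \<Longrightarrow> T = R"
    using exists_max_subspace[of "\<lambda>I. ideal_of I A \<and> P I" "{0}"] ideal_ofD(1) by metis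
  have sub: "I \<subseteq> R" if I: "ideal_of I A" "P I" for I
  proof -
    let ?S = "{x + y | x y. x \<in> R \<and> y \<in> I}"
    have "R \<subseteq> ?S" using subspace_0[OF ideal_ofD(1)[OF I(1)]] by force
    moreover have "ideal_of ?S A" "P ?S"
      using ideal_of_set_sum[OF A R(1) I(1)] P_sum[OF A R(1,2) I] by auto
    ultimately have "?S = R" using R(3) by blast
    moreover have "I \<subseteq> ?S" using subspace_0[OF ideal_ofD(1)[OF R(1)]] by force
    ultimately show "I \<subseteq> R" by simp
  qed
  have "radical A = R"
    unfolding radical_def
  proof (rule the_equality)
    show "ideal_of R A \<and> P R \<and> (\<forall>I. ideal_of I A \<and> P I \<and> R \<subseteq> I \<longrightarrow> I = R)" using R by blast
    fix R' assume "ideal_of R' A \<and> P R' \<and> (\<forall>I. ideal_of I A \<and> P I \<and> R' \<subseteq> I \<longrightarrow> I = R')"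
    then show "R' = R" using sub R by blast
  qed
  then show "ideal_of (radical A) A" "P (radical A)" "ideal_of I A \<Longrightarrow> P I \<Longrightarrow> I \<subseteq> radical A"
    using R sub by auto
qed

section \<open>Divided powers of left multiplications and stability of the radical\<close>

definition divided_power :: "'a \<Rightarrow> nat \<Rightarrow> 'a \<Rightarrow> 'a" where
  "divided_power a n x = inverse (fact n) *s ((\<lambda>y. a \<cdot> y) ^^ n) x"

lemma divided_power_Suc: "of_nat (Suc n) *s divided_power a (Suc n) x = a \<cdot> divided_power a n x"
  by (simp add: divided_power_def mul_scale_right field_simps del: of_nat_Suc)

text \<open>The Leibniz rule divided by factorials. Induction after multiplying by
  \<open>Suc n\<close> replaces binomial coefficients by the weights \<open>i\<close> and
  \<open>Suc n - i\<close>, which add up to \<open>Suc n\<close>; characteristic zero permits the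
  final cancellation.\<close>

lemma divided_power_mul:
  "divided_power a n (x \<cdot> y) = (\<Sum>i\<le>n. divided_power a i x \<cdot> divided_power a (n - i) y)"
proof (induction n)
  case 0
  then show ?case by (simp add: divided_power_def)
next
  case (Suc n)
  let ?E = "divided_power a"
  have "of_nat (Suc n) *s ?E (Suc n) (x \<cdot> y) = (\<Sum>i\<le>n. a \<cdot> (?E i x \<cdot> ?E (n - i) y))"
    by (simp add: divided_power_Suc Suc ring.right.sum del: of_nat_Suc)
  also have "\<dots> = (\<Sum>i\<le>n. of_nat (Suc i) *s (?E (Suc i) x \<cdot> ?E (n - i) y))
      + (\<Sum>i\<le>n. of_nat (Suc n - i) *s (?E i x \<cdot> ?E (Suc n - i) y))"
    by (simp add: left_leibniz[of a] divided_power_Suc[symmetric] mul_scale_left mul_scale_right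
        sum.distrib Suc_diff_le del: of_nat_Suc)
  \<comment> \<open>After the shift the term \<open>i = 0\<close> has weight 0; in the second sum
    the added term \<open>i = Suc n\<close> has weight 0.\<close>
  also have "(\<Sum>i\<le>n. of_nat (Suc i) *s (?E (Suc i) x \<cdot> ?E (n - i) y))
      = (\<Sum>i\<le>Suc n. of_nat i *s (?E i x \<cdot> ?E (Suc n - i) y))"
    by (simp add: sum.atMost_Suc_shift del: of_nat_Suc sum.atMost_Suc)
  also have "(\<Sum>i\<le>n. of_nat (Suc n - i) *s (?E i x \<cdot> ?E (Suc n - i) y))
      = (\<Sum>i\<le>Suc n. of_nat (Suc n - i) *s (?E i x \<cdot> ?E (Suc n - i) y))"
    by simp
  also have "(\<Sum>i\<le>Suc n. of_nat i *s (?E i x \<cdot> ?E (Suc n - i) y)) + \<dots>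
      = (\<Sum>i\<le>Suc n. of_nat (Suc n) *s (?E i x \<cdot> ?E (Suc n - i) y))"
    unfolding sum.distrib[symmetric]
    by (rule sum.cong) (auto simp flip: scale_left_distrib of_nat_add)
  also have "\<dots> = of_nat (Suc n) *s (\<Sum>i\<le>Suc n. ?E i x \<cdot> ?E (Suc n - i) y)"
    by (simp only: scale_sum_right)
  finally show ?case using scale_cancel_left of_nat_neq_0 by blast
qed

lemma hasse_schmidt_divided_power: "hasse_schmidt_derivation mul (divided_power a)"
proof
  fix n x y
  have "((\<lambda>y. a \<cdot> y) ^^ n) (x + y) = ((\<lambda>y. a \<cdot> y) ^^ n) x + ((\<lambda>y. a \<cdot> y) ^^ n) y"
    by (induction n) (auto simp: mul_add_right)
  then show "divided_power a n (x + y) = divided_power a n x + divided_power a n y"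
    by (simp add: divided_power_def scale_right_distrib)
  show "divided_power a 0 x = x" by (simp add: divided_power_def)
  show "divided_power a n (x \<cdot> y) = (\<Sum>i\<le>n. divided_power a i x \<cdot> divided_power a (n - i) y)"
    by (rule divided_power_mul)
qed

lemma divided_power_in:
  assumes "subspace I" "\<And>x. x \<in> I \<Longrightarrow> a \<cdot> x \<in> I" "x \<in> I"
  shows "divided_power a n x \<in> I"
proof -
  have "((\<lambda>y. a \<cdot> y) ^^ n) x \<in> I" using assms by (induction n) auto
  then show ?thesis using assms(1) by (simp add: divided_power_def subspace_scale)
qed

text \<open>For R = \<open>radical I\<close>, the space R + a R has \<open>P\<close> by the power
  series argument and is an ideal of \<open>I\<close>, hence lies in R by maximality.\<close>

lemma radical_left_stable:
  assumes I: "ideal_of I A" and a: "a \<in> A" and x: "x \<in> radical I"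
  shows "a \<cdot> x \<in> radical I"
proof -
  note I' = subalgebra_ideal_of[OF I]
  let ?R = "radical I"
  note R = radical_greatest[OF I']
  interpret hasse_schmidt_derivation mul "divided_power a" by (rule hasse_schmidt_divided_power)
  have d1: "divided_power a (Suc 0) y = a \<cdot> y" for y by (simp add: divided_power_def)
  let ?M = "{x + a \<cdot> y | x y. x \<in> ?R \<and> y \<in> ?R}"
  have "vanishing sh mul ?M"
    using vanishing_derivation_sum[OF sh _ _ _ ideal_in_ideal_of[OF R(1)]]
      I' ideal_ofD(4)[OF I _ a] R(2) P_iff[OF ideal_ofD(1)[OF R(1)]]
    by (simp add: d1 subalgebra_def additive_subgroup_subspace divided_power_in)
  have "subspace ((\<lambda>y. a \<cdot> y) ` ?R)"
    using ideal_ofD(1)[OF R(1)] linear_mul_left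
    by (intro module_hom.subspace_image[of scale scale]) (simp_all add: module_hom_iff_linear)
  from subspace_sums[OF ideal_ofD(1)[OF R(1)] this]
  have "subspace ?M" by (rule back_subst[of subspace]) blast
  moreover have "ideal_of ?M I"
    unfolding ideal_of_def
  proof (intro conjI ballI)
    show "subspace ?M" by fact
    show "?M \<subseteq> I"
      using ideal_ofD(1)[OF I] ideal_ofD(2)[OF R(1)] ideal_ofD(4)[OF I _ a]
      by (auto intro!: subspace_add)
    fix z w assume "z \<in> ?M" and w: "w \<in> I"
    then obtain x y where z: "z = x + a \<cdot> y" "x \<in> ?R" "y \<in> ?R" by blast
    have aw: "a \<cdot> w \<in> I" using ideal_ofD(4)[OF I w a] .
    \<comment> \<open>The factor \<open>a\<close> is moved outside by the derivation rule; the
      correction term lies in \<open>?R\<close> because \<open>a \<cdot> w\<close> is still in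
      \<open>I\<close>.\<close>
    have "(a \<cdot> y) \<cdot> w = a \<cdot> (y \<cdot> w) - y \<cdot> (a \<cdot> w)" by (simp add: left_leibniz[of a])
    then have "z \<cdot> w = (x \<cdot> w - y \<cdot> (a \<cdot> w)) + a \<cdot> (y \<cdot> w)" by (simp add: z(1) mul_add_left)
    moreover have "x \<cdot> w - y \<cdot> (a \<cdot> w) \<in> ?R" "y \<cdot> w \<in> ?R"
      using z w aw ideal_ofD(3)[OF R(1)] subspace_diff[OF ideal_ofD(1)[OF R(1)]] by auto
    ultimately show "z \<cdot> w \<in> ?M" by blast
    have "w \<cdot> (a \<cdot> y) = a \<cdot> (w \<cdot> y) - (a \<cdot> w) \<cdot> y" by (simp add: left_leibniz[of a])
    then have "w \<cdot> z = (w \<cdot> x - (a \<cdot> w) \<cdot> y) + a \<cdot> (w \<cdot> y)" by (simp add: z(1) mul_add_right)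
    moreover have "w \<cdot> x - (a \<cdot> w) \<cdot> y \<in> ?R" "w \<cdot> y \<in> ?R"
      using z w aw ideal_ofD(4)[OF R(1)] subspace_diff[OF ideal_ofD(1)[OF R(1)]] by auto
    ultimately show "w \<cdot> z \<in> ?M" by blast
  qed
  ultimately have "?M \<subseteq> ?R" using R(3) P_iff \<open>vanishing sh mul ?M\<close> by blast
  moreover have "a \<cdot> x \<in> ?M" using x subspace_0[OF ideal_ofD(1)[OF R(1)]] by force
  ultimately show ?thesis by blast
qed

text \<open>The symmetrised product \<open>x \<cdot> a + a \<cdot> x\<close> annihilates everything from the left, and the left
  annihilator in \<open>I\<close> is an abelian ideal of \<open>I\<close>.\<close>

lemma radical_right_stable:
  assumes I: "ideal_of I A" and a: "a \<in> A" and x: "x \<in> radical I"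
  shows "x \<cdot> a \<in> radical I"
proof -
  let ?R = "radical I"
  note R = radical_greatest[OF subalgebra_ideal_of[OF I]]
  let ?Z = "{z \<in> I. \<forall>y. z \<cdot> y = 0}"
  \<comment> \<open>Here \<open>(y \<cdot> z) \<cdot> w = y \<cdot> (z \<cdot> w) - z \<cdot> (y
    \<cdot> w)\<close>, and both terms vanish.\<close>
  have Z0: "(y \<cdot> z) \<cdot> w = 0" if "\<forall>y. z \<cdot> y = 0" for y z w
    using left_leibniz[of y z w] that by (simp add: ring.right.zero)
  have subZ: "subspace ?Z"
    using ideal_ofD(1)[OF I]
    by (auto simp: subspace_def mul_add_left mul_scale_left ring.left.zero)
  have "ideal_of ?Z I"
    unfolding ideal_of_def using subZ ideal_ofD[OF I] Z0 subspace_0[OF ideal_ofD(1)[OF I]]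
    by (auto simp: ring.left.zero)
  moreover have "P ?Z" by (rule P_zero_mul[OF subZ]) auto
  ultimately have "?Z \<subseteq> ?R" using R(3) by blast
  moreover have "x \<cdot> a + a \<cdot> x \<in> ?Z"
  proof -
    have "x \<in> I" using x ideal_ofD(2)[OF R(1)] by blast
    then have "x \<cdot> a + a \<cdot> x \<in> I"
      using a ideal_ofD(3,4)[OF I] subspace_add[OF ideal_ofD(1)[OF I]] by blast
    \<comment> \<open>Adding the Leibniz identities for \<open>x, a, y\<close> and
      \<open>a, x, y\<close> cancels the iterated products.\<close>
    moreover have "(x \<cdot> a + a \<cdot> x) \<cdot> y = 0" for y
      using left_leibniz[of x a y] left_leibniz[of a x y] by (simp add: mul_add_left)
    ultimately show ?thesis by blast
  qed
  ultimately have "(x \<cdot> a + a \<cdot> x) - a \<cdot> x \<in> ?R"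
    using radical_left_stable[OF I a x] subspace_diff[OF ideal_ofD(1)[OF R(1)]] by blast
  then show ?thesis by simp
qed

section \<open>Passage to ideals and to subinvariant chains\<close>

lemma radical_ideal:
  assumes A: "subalgebra A" and I: "ideal_of I A"
  shows "radical I = I \<inter> radical A"
proof (rule antisym)
  note RI = radical_greatest[OF subalgebra_ideal_of[OF I]] and RA = radical_greatest[OF A]
  \<comment> \<open>Stability under both multiplications by \<open>A\<close> makes
    \<open>radical I\<close> one of the ideals that \<open>radical A\<close> contains.\<close>
  have "ideal_of (radical I) A"
    unfolding ideal_of_def
  proof (intro conjI ballI)
    show "subspace (radical I)" by (rule ideal_ofD(1)[OF RI(1)])
    show "radical I \<subseteq> A" using ideal_ofD(2)[OF RI(1)] ideal_ofD(2)[OF I] by (rule subset_trans)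
  qed (rule radical_right_stable[OF I] radical_left_stable[OF I]; assumption)+
  from RA(3)[OF this RI(2)] show "radical I \<subseteq> I \<inter> radical A"
    using ideal_ofD(2)[OF RI(1)] by simp
  have sub: "subspace (I \<inter> radical A)"
    using ideal_ofD(1)[OF I] ideal_ofD(1)[OF RA(1)] by (rule subspace_inter)
  have "ideal_of (I \<inter> radical A) I"
    unfolding ideal_of_def
  proof (intro conjI ballI)
    fix x y assume "x \<in> I \<inter> radical A" "y \<in> I"
    moreover from this have "y \<in> A" using ideal_ofD(2)[OF I] by blast
    ultimately show "x \<cdot> y \<in> I \<inter> radical A" "y \<cdot> x \<in> I \<inter> radical A"
      using ideal_ofD(3,4)[OF I] ideal_ofD(3,4)[OF RA(1)] by simp_all
  qed (use sub in auto)
  moreover have "P (I \<inter> radical A)"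
    using P_subspace_mono[OF RA(2) sub ideal_ofD(1)[OF RA(1)]] by blast
  ultimately show "I \<inter> radical A \<subseteq> radical I" by (rule RI(3))
qed

lemma radical_subinvariant:
  assumes "subinvariant B A"
  shows "radical B = B \<inter> radical A"
proof -
  obtain t C where C: "C 0 = A" "C t = B" "\<And>i. i \<le> t \<Longrightarrow> subalgebra (C i)"
    "\<And>i. i \<in> {1..t::nat} \<Longrightarrow> ideal_of (C i) (C (i - 1))"
    using assms unfolding subinvariant_def by blast
  \<comment> \<open>Each step intersects with the next member of the chain; since
    \<open>C (Suc k)\<close> lies in \<open>C k\<close>, the intersections collapse.\<close>
  have "k \<le> t \<Longrightarrow> radical (C k) = C k \<inter> radical A" for k
  proof (induction k)
    case 0
    then show ?case using ideal_ofD(2)[OF radical_greatest(1)[OF C(3)[of 0]]] C(1) by auto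
  next
    case (Suc k)
    have "ideal_of (C (Suc k)) (C k)" using C(4)[of "Suc k"] Suc.prems by simp
    then show ?case using radical_ideal[of "C k"] C(3)[of k] Suc ideal_ofD(2) by fastforce
  qed
  then show ?thesis using C(2) by blast
qed

end

theorem theorem3p10:
  fixes scale :: "'f::field_char_0 \<Rightarrow> 'a::ab_group_add \<Rightarrow> 'a"
    and mul :: "'a \<Rightarrow> 'a \<Rightarrow> 'a"
    and B :: "'a set"
  assumes "leibniz_algebra scale mul"
    and "leibniz_algebra.subalgebra scale mul B"
    and "leibniz_algebra.subinvariant scale mul B UNIV"
  shows "leibniz_algebra.rad scale mul B = B \<inter> leibniz_algebra.rad scale mul UNIV \<and>
    leibniz_algebra.nilrad scale mul B = B \<inter> leibniz_algebra.nilrad scale mul UNIV"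
proof -
  interpret leibniz_algebra scale mul by fact
  interpret s: radical_property scale mul solvable full_tree
    by unfold_locales (auto simp: solvable_iff_vanishing)
  interpret n: radical_property scale mul nilpotent right_comb
    by unfold_locales (auto simp: nilpotent_iff_vanishing)
  show ?thesis
    using s.radical_subinvariant[OF assms(3)] n.radical_subinvariant[OF assms(3)]
    by (simp add: s.radical_def n.radical_def rad_def nilrad_def)
qed

end
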